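(* Let $\varepsilon>0$ and let $f$ be the probability density of a square-integrable real random variable $X$ with $E X=0$. Let $\mathcal P$, $\mathcal D$ and $\Phi$ be the primal-feasible set, the dual-feasible set and the objective defined in the context (they depend on $f$ and $\varepsilon$). Suppose that $g_*\in\mathcal P$ and $(\alpha_*,\beta_*,\gamma_*,\lambda_* )\in\mathcal D$ satisfy the complementary slackness conditions $$0=\Bigl[\alpha_*+\beta_* y+\gamma_* y^2-\int f(s-y)\,(s-y-\lambda_*(s))^2\,ds\Bigr]\,g_*(y)\quad\text{for all } y\in\mathbb R,$$ $$0=\gamma_* z_*,\qquad\text{where } z_*=\varepsilon-\int y^2 g_*(y)\,dy,$$ and that $$\lambda_*(s)=\frac{\int x f(x)\,g_*(s-x)\,dx}{(f*g_* )(s)}\quad\text{for all } s \text{ with } (f*g_* )(s)>0.$$ Then $g_*$ is optimal, that is, $\Phi(g_* )=\inf_{g\in\mathcal P}\Phi(g)$.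
   Context: Densities are with respect to Lebesgue measure on $\mathbb R$, integrals are over $\mathbb R$, and $(f*g)(s)=\int f(x)g(s-x)\,dx$ denotes convolution. The primal-feasible set is $$\mathcal P=\Bigl\{g:\mathbb R\to[0,\infty)\text{ measurable}:\ \int g(y)\,dy=1,\ \int y\,g(y)\,dy=0,\ \int y^2 g(y)\,dy\le\varepsilon\Bigr\}.$$ For $g\in\mathcal P$, the objective is $$\Phi(g)=\int \lambda_g(s)^2\,(f*g)(s)\,ds,\qquad \lambda_g(s)=\frac{\int x f(x)g(s-x)\,dx}{(f*g)(s)},$$ where the integrand is taken to be $0$ where $(f*g)(s)=0$. If $Y$ is independent of $X$ with density $g$, then $\lambda_g(s)=E[X\mid X+Y=s]$ and $\Phi(g)=E\bigl(E[X\mid X+Y]^2\bigr)$. The dual-feasible set $\mathcal D$ consists of all $(\alpha,\beta,\gamma,\lambda)$ with $\alpha,\beta\in\mathbb R$, $\gamma\ge 0$ and $\lambda:\mathbb R\to\mathbb R$ measurable such that $$0\le \alpha+\beta y+\gamma y^2-\int f(s-y)\,(s-y-\lambda(s))^2\,ds\qquad\text{for all } y\in\mathbb R.$$ *)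

theory Defs
  imports "HOL-Probability.Probability"
begin

text \<open>
  The Bochner integral is \<open>0\<close> for functions that are not integrable. Wherever the
  mathematics requires an integral to be finite, integrability is therefore stated explicitly.
\<close>

definition convol :: "(real \<Rightarrow> real) \<Rightarrow> (real \<Rightarrow> real) \<Rightarrow> real \<Rightarrow> real" where
  "convol f g s = (\<integral>x. f x * g (s - x) \<partial>lborel)"

text \<open>Integrability of \<open>g\<close> follows from its integral being \<open>1\<close>, and integrability of
  \<open>\<lambda>y. y * g y\<close> then follows from that of \<open>\<lambda>y. y\<^sup>2 * g y\<close>.\<close>

definition primal_feasible :: "real \<Rightarrow> (real \<Rightarrow> real) set" where
  "primal_feasible \<epsilon> = {g. g \<in> borel_measurable borel \<and> (\<forall>y. 0 \<le> g y)
     \<and> (\<integral>y. g y \<partial>lborel) = 1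
     \<and> (\<integral>y. y * g y \<partial>lborel) = 0
     \<and> integrable lborel (\<lambda>y. y\<^sup>2 * g y) \<and> (\<integral>y. y\<^sup>2 * g y \<partial>lborel) \<le> \<epsilon>}"

definition cond_mean :: "(real \<Rightarrow> real) \<Rightarrow> (real \<Rightarrow> real) \<Rightarrow> real \<Rightarrow> real" where
  "cond_mean f g s = (\<integral>x. x * f x * g (s - x) \<partial>lborel) / convol f g s"

text \<open>For nonnegative \<open>f\<close> and \<open>g\<close> with finite integrals, the integrals over \<open>x\<close> that define
  \<open>convol f g s\<close> (and, if \<open>f\<close> has a finite first absolute moment, the numerator of
  \<open>cond_mean f g s\<close>) are finite for almost every \<open>s\<close>, so the values at the
  remaining \<open>s\<close> do not affect the objective. The integrand is \<open>0\<close> where \<open>convol f g s = 0\<close>.\<close>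

definition objective :: "(real \<Rightarrow> real) \<Rightarrow> (real \<Rightarrow> real) \<Rightarrow> real" where
  "objective f g = (\<integral>s. (cond_mean f g s)\<^sup>2 * convol f g s \<partial>lborel)"

definition dual_slack ::
  "(real \<Rightarrow> real) \<Rightarrow> real \<Rightarrow> real \<Rightarrow> real \<Rightarrow> (real \<Rightarrow> real) \<Rightarrow> real \<Rightarrow> real" where
  "dual_slack f \<alpha> \<beta> \<gamma> l y =
     \<alpha> + \<beta> * y + \<gamma> * y\<^sup>2 - (\<integral>s. f (s - y) * (s - y - l s)\<^sup>2 \<partial>lborel)"

text \<open>The integral in the dual constraint has a nonnegative integrand. If it were infinite, the
  constraint would fail; this is why integrability is part of dual feasibility.\<close>

definition dual_feasible ::
  "(real \<Rightarrow> real) \<Rightarrow> (real \<times> real \<times> real \<times> (real \<Rightarrow> real)) set" where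
  "dual_feasible f = {(\<alpha>, \<beta>, \<gamma>, l). 0 \<le> \<gamma> \<and> l \<in> borel_measurable borel
     \<and> (\<forall>y. integrable lborel (\<lambda>s. f (s - y) * (s - y - l s)\<^sup>2)
            \<and> 0 \<le> dual_slack f \<alpha> \<beta> \<gamma> l y)}"

end

theory Submission
  imports Defs
begin

text \<open>
  This is weak duality for the estimation of \<open>X\<close> from \<open>S = X + Y\<close>, where \<open>Y\<close> is independent of
  \<open>X\<close> and has density \<open>g\<close>. An estimator \<open>l\<close> has the mean square error
  \<open>R(g, l) = E (X - l(S))\<^sup>2\<close>, which can be computed in two ways.

  Conditioning on \<open>S\<close> gives the bias-variance decomposition (lemma \<open>mean_square_error_eq\<close>)
    \<open>R(g, l) = E X\<^sup>2 - \<Phi>(g) + E (l(S) - E[X | S])\<^sup>2\<close>,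
  so that \<open>R(g, l) \<ge> E X\<^sup>2 - \<Phi>(g)\<close>, with equality if \<open>l\<close> is the conditional mean.

  Conditioning on \<open>Y\<close> instead gives the integral of \<open>g(y)\<close> against the function of \<open>y\<close>
  that the dual constraint bounds by \<open>\<alpha> + \<beta> y + \<gamma> y\<^sup>2\<close>. As \<open>E Y = 0\<close>, this yields
  (lemma \<open>mean_square_error_dual\<close>)
    \<open>R(g, l) = \<alpha> + \<gamma> E Y\<^sup>2 - E slack(Y) \<le> \<alpha> + \<gamma> \<epsilon>\<close>,
  where the slack is the nonnegative gap in the dual constraint.

  Together, \<open>E X\<^sup>2 - \<Phi>(g) \<le> \<alpha> + \<gamma> \<epsilon>\<close> for every feasible \<open>g\<close>. The complementary slackness
  conditions, and the assumption that the dual estimator is the conditional mean under the given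
  primal point, turn each inequality into an equality at that point, which is therefore a
  minimizer. The rest is integrability: the convolution integrals are finite only for almost
  every \<open>s\<close>, and the order of integration has to be exchanged.
\<close>

section \<open>First moments and convolution integrals\<close>

lemma integrable_first_moment:
  fixes w :: "real \<Rightarrow> real"
  assumes [measurable]: "w \<in> borel_measurable borel"
    and nonneg: "\<And>x. 0 \<le> w x"
    and w0: "integrable lborel w"
    and w2: "integrable lborel (\<lambda>x. x\<^sup>2 * w x)"
  shows "integrable lborel (\<lambda>x. x * w x)"
proof (rule Bochner_Integration.integrable_bound)
  show "integrable lborel (\<lambda>x. w x + x\<^sup>2 * w x)"
    using w0 w2 by simp
  have "norm (x * w x) \<le> norm (w x + x\<^sup>2 * w x)" for x
  proof -
    have "2 * \<bar>x\<bar> \<le> 1 + x\<^sup>2"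
      using zero_le_power2[of "\<bar>x\<bar> - 1"] by (simp add: power2_diff)
    then have "\<bar>x\<bar> \<le> 1 + x\<^sup>2" by simp
    then have "\<bar>x\<bar> * w x \<le> (1 + x\<^sup>2) * w x"
      using nonneg by (rule mult_right_mono)
    then show ?thesis using nonneg[of x] by (simp add: abs_mult algebra_simps)
  qed
  then show "AE x in lborel. norm (x * w x) \<le> norm (w x + x\<^sup>2 * w x)" by simp
qed measurable

text \<open>
  The joint integrability behind Fubini's theorem for convolutions, for \<open>u\<close> of either sign: it
  is used for the zeroth, first and second moment of \<open>f\<close>.
\<close>

lemma integrable_convolution_kernel:
  fixes u g :: "real \<Rightarrow> real"
  assumes u: "integrable lborel u" and g: "integrable lborel g"
  shows "integrable (lborel \<Otimes>\<^sub>M lborel) (\<lambda>(s, x). u x * g (s - x))"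
proof -
  have [measurable]: "u \<in> borel_measurable borel" "g \<in> borel_measurable borel"
    using u g by auto
  have shift: "integrable lborel (\<lambda>s. g (s - x))" for x
    using lborel_integrable_real_affine[OF g, of 1 "- x"] by simp
  have norm_shift: "(\<integral>s. norm (u x * g (s - x)) \<partial>lborel) = \<bar>u x\<bar> * (\<integral>y. \<bar>g y\<bar> \<partial>lborel)" for x
    using lborel_integral_real_affine[of 1 "\<lambda>y. \<bar>g y\<bar>" "- x"] by (simp add: abs_mult)
  have "integrable (lborel \<Otimes>\<^sub>M lborel) (\<lambda>(x, s). u x * g (s - x))"
  proof (rule lborel_pair.Fubini_integrable)
    show "integrable lborel (\<lambda>x. \<integral>s. norm (case (x, s) of (x, s) \<Rightarrow> u x * g (s - x)) \<partial>lborel)"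
      unfolding prod.case norm_shift using u by auto
  qed (use shift in auto)
  from lborel_pair.integrable_product_swap[OF this] show ?thesis
    by (simp add: case_prod_unfold)
qed

lemma
  fixes u g :: "real \<Rightarrow> real"
  assumes u: "integrable lborel u" and g: "integrable lborel g"
  shows AE_integrable_convolution: "AE s in lborel. integrable lborel (\<lambda>x. u x * g (s - x))"
    and integrable_convol: "integrable lborel (convol u g)"
    and integral_convol:
      "(\<integral>s. convol u g s \<partial>lborel) = (\<integral>x. u x \<partial>lborel) * (\<integral>y. g y \<partial>lborel)"
proof -
  note kernel = integrable_convolution_kernel[OF u g]
  show "AE s in lborel. integrable lborel (\<lambda>x. u x * g (s - x))"
    using lborel_pair.AE_integrable_fst'[OF kernel] by simp
  show "integrable lborel (convol u g)"
    using lborel_pair.integrable_fst'[OF kernel] by (simp add: convol_def[abs_def])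
  have "(\<integral>s. convol u g s \<partial>lborel) = (\<integral>x. (\<integral>s. u x * g (s - x) \<partial>lborel) \<partial>lborel)"
    using lborel_pair.Fubini_integral[OF kernel] by (simp add: convol_def)
  also have "\<dots> = (\<integral>x. u x * (\<integral>y. g y \<partial>lborel) \<partial>lborel)"
  proof (rule Bochner_Integration.integral_cong)
    fix x show "(\<integral>s. u x * g (s - x) \<partial>lborel) = u x * (\<integral>y. g y \<partial>lborel)"
      using lborel_integral_real_affine[of 1 g "- x"] by simp
  qed simp
  finally show "(\<integral>s. convol u g s \<partial>lborel) = (\<integral>x. u x \<partial>lborel) * (\<integral>y. g y \<partial>lborel)"
    by simp
qed

section \<open>The mean square error conditioned on the sum\<close>

text \<open>
  The second moment of a weight \<open>w\<close> about a point \<open>a\<close>, split at the centre of mass. The formula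
  survives a weight of total mass \<open>0\<close>: such a weight vanishes almost everywhere, and so does its
  first moment, whatever value the quotient then has.
\<close>

lemma second_moment_about_point:
  fixes w :: "real \<Rightarrow> real"
  assumes nonneg: "\<And>x. 0 \<le> w x"
    and w0: "integrable lborel w"
    and w1: "integrable lborel (\<lambda>x. x * w x)"
    and w2: "integrable lborel (\<lambda>x. x\<^sup>2 * w x)"
  defines "h \<equiv> \<integral>x. w x \<partial>lborel"
  defines "c \<equiv> (\<integral>x. x * w x \<partial>lborel) / h"
  shows "(\<integral>x. (x - a)\<^sup>2 * w x \<partial>lborel) = (\<integral>x. x\<^sup>2 * w x \<partial>lborel) - c\<^sup>2 * h + (a - c)\<^sup>2 * h"
proof -
  have first_moment: "(\<integral>x. x * w x \<partial>lborel) = c * h"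
  proof (cases "h = 0")
    case True
    then have "AE x in lborel. w x = 0"
      using integral_nonneg_eq_0_iff_AE[OF w0] nonneg by (simp add: h_def)
    then have "(\<integral>x. x * w x \<partial>lborel) = 0"
      by (intro integral_eq_zero_AE) auto
    with True show ?thesis by simp
  qed (simp add: c_def)
  have "(\<integral>x. (x - a)\<^sup>2 * w x \<partial>lborel) = (\<integral>x. x\<^sup>2 * w x - 2 * a * (x * w x) + a\<^sup>2 * w x \<partial>lborel)"
    by (intro Bochner_Integration.integral_cong) (simp_all add: power2_eq_square algebra_simps)
  also have "\<dots> = (\<integral>x. x\<^sup>2 * w x \<partial>lborel) - 2 * a * (c * h) + a\<^sup>2 * h"
    using w0 w1 w2 by (simp add: first_moment h_def)
  finally show ?thesis
    by (simp add: power2_eq_square algebra_simps)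
qed

text \<open>
  The bias-variance decomposition. For fixed \<open>s\<close> it is the previous lemma with the weight
  \<open>f x * g (s - x)\<close>, the density of \<open>X\<close> jointly with \<open>S = s\<close>; integrating over \<open>s\<close> gives the
  claim. Applied with \<open>a\<close> the centre of mass, the same lemma also shows that the integrand of the
  objective is at most the second moment of the weight, and is therefore integrable.
\<close>

lemma mean_square_error_eq:
  fixes f g l :: "real \<Rightarrow> real"
  assumes f_nonneg: "\<And>x. 0 \<le> f x" and g_nonneg: "\<And>y. 0 \<le> g y"
    and f0: "integrable lborel f"
    and f1: "integrable lborel (\<lambda>x. x * f x)"
    and f2: "integrable lborel (\<lambda>x. x\<^sup>2 * f x)"
    and g: "integrable lborel g" and g_mass: "(\<integral>y. g y \<partial>lborel) = 1"
    and [measurable]: "l \<in> borel_measurable borel"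
    and risk: "integrable lborel (\<lambda>s. \<integral>x. (x - l s)\<^sup>2 * (f x * g (s - x)) \<partial>lborel)"
  shows "(\<integral>s. (\<integral>x. (x - l s)\<^sup>2 * (f x * g (s - x)) \<partial>lborel) \<partial>lborel) =
      (\<integral>x. x\<^sup>2 * f x \<partial>lborel) - objective f g
        + (\<integral>s. (l s - cond_mean f g s)\<^sup>2 * convol f g s \<partial>lborel)"
proof -
  let ?R = "\<lambda>s. \<integral>x. (x - l s)\<^sup>2 * (f x * g (s - x)) \<partial>lborel"
  let ?m = "convol (\<lambda>x. x\<^sup>2 * f x) g"
  let ?v = "\<lambda>s. (cond_mean f g s)\<^sup>2 * convol f g s"
  let ?b = "\<lambda>s. (l s - cond_mean f g s)\<^sup>2 * convol f g s"
  have decomp: "AE s in lborel. \<forall>a. (\<integral>x. (x - a)\<^sup>2 * (f x * g (s - x)) \<partial>lborel)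
      = ?m s - ?v s + (a - cond_mean f g s)\<^sup>2 * convol f g s"
    using AE_integrable_convolution[OF f0 g] AE_integrable_convolution[OF f1 g]
      AE_integrable_convolution[OF f2 g]
  proof eventually_elim
    case (elim s)
    show ?case
    proof
      fix a
      show "(\<integral>x. (x - a)\<^sup>2 * (f x * g (s - x)) \<partial>lborel)
          = ?m s - ?v s + (a - cond_mean f g s)\<^sup>2 * convol f g s"
        using second_moment_about_point[of "\<lambda>x. f x * g (s - x)" a] elim f_nonneg g_nonneg
        by (simp add: convol_def cond_mean_def mult.assoc)
    qed
  qed
  have convol_nonneg: "0 \<le> convol f g s" for s
    unfolding convol_def by (intro Bochner_Integration.integral_nonneg mult_nonneg_nonneg f_nonneg g_nonneg)
  have v_le_m: "AE s in lborel. ?v s \<le> ?m s"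
    using decomp
  proof eventually_elim
    case (elim s)
    have "0 \<le> (\<integral>x. (x - cond_mean f g s)\<^sup>2 * (f x * g (s - x)) \<partial>lborel)"
      by (intro Bochner_Integration.integral_nonneg mult_nonneg_nonneg f_nonneg g_nonneg) simp
    also have "\<dots> = ?m s - ?v s"
      using elim by simp
    finally show ?case by simp
  qed
  have [measurable]: "convol f g \<in> borel_measurable borel"
    using integrable_convol[OF f0 g] by auto
  have "convol (\<lambda>x. x * f x) g \<in> borel_measurable borel"
    using integrable_convol[OF f1 g] by auto
  then have [measurable]: "cond_mean f g \<in> borel_measurable borel"
    unfolding cond_mean_def[abs_def] convol_def[of "\<lambda>x. x * f x", abs_def] by measurable
  have m: "integrable lborel ?m"
    by (rule integrable_convol[OF f2 g])
  have v: "integrable lborel ?v"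
  proof (rule Bochner_Integration.integrable_bound[OF m])
    show "AE s in lborel. norm (?v s) \<le> norm (?m s)"
      using v_le_m
    proof eventually_elim
      case (elim s)
      have "0 \<le> ?v s" using convol_nonneg by simp
      with elim show ?case by simp
    qed
  qed measurable
  have "(\<integral>s. ?b s \<partial>lborel) = (\<integral>s. ?R s - ?m s + ?v s \<partial>lborel)"
  proof (rule integral_cong_AE)
    show "AE s in lborel. ?b s = ?R s - ?m s + ?v s"
      using decomp by eventually_elim simp
    show "(\<lambda>s. ?R s - ?m s + ?v s) \<in> borel_measurable lborel"
      using risk m v by auto
  qed measurable
  also have "\<dots> = (\<integral>s. ?R s \<partial>lborel) - (\<integral>x. x\<^sup>2 * f x \<partial>lborel) + objective f g"
    using risk m v by (simp add: integral_convol[OF f2 g] g_mass objective_def)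
  finally show ?thesis by simp
qed

section \<open>The mean square error conditioned on the noise\<close>

text \<open>
  The mean square error in terms of the dual slack, by conditioning on \<open>Y\<close>. The dual constraint
  also supplies the integrability needed to exchange the integrals: it bounds the inner integral,
  weighted by \<open>g y\<close>, by a combination of moments of \<open>g\<close>.
\<close>

lemma
  fixes f g l :: "real \<Rightarrow> real"
  assumes [measurable]: "f \<in> borel_measurable borel"
    and f_nonneg: "\<And>x. 0 \<le> f x"
    and primal: "g \<in> primal_feasible \<epsilon>"
    and dual: "(\<alpha>, \<beta>, \<gamma>, l) \<in> dual_feasible f"
  shows mean_square_error_integrable:
      "integrable lborel (\<lambda>s. \<integral>x. (x - l s)\<^sup>2 * (f x * g (s - x)) \<partial>lborel)"
    and mean_square_error_dual:
      "(\<integral>s. (\<integral>x. (x - l s)\<^sup>2 * (f x * g (s - x)) \<partial>lborel) \<partial>lborel) =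
        \<alpha> + \<gamma> * (\<integral>y. y\<^sup>2 * g y \<partial>lborel) - (\<integral>y. dual_slack f \<alpha> \<beta> \<gamma> l y * g y \<partial>lborel)"
proof -
  have [measurable]: "g \<in> borel_measurable borel" and g_nonneg: "\<And>y. 0 \<le> g y"
    and g_mass: "(\<integral>y. g y \<partial>lborel) = 1" and g_mean: "(\<integral>y. y * g y \<partial>lborel) = 0"
    and g2: "integrable lborel (\<lambda>y. y\<^sup>2 * g y)"
    using primal by (auto simp: primal_feasible_def)
  have [measurable]: "l \<in> borel_measurable borel"
    and inner: "\<And>y. integrable lborel (\<lambda>s. f (s - y) * (s - y - l s)\<^sup>2)"
    and slack: "\<And>y. 0 \<le> dual_slack f \<alpha> \<beta> \<gamma> l y"
    using dual by (auto simp: dual_feasible_def)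
  (* a function that is not integrable would have integral 0, not 1 *)
  have g0: "integrable lborel g"
    using g_mass not_integrable_integral_eq by fastforce
  have g1: "integrable lborel (\<lambda>y. y * g y)"
    by (rule integrable_first_moment[OF _ g_nonneg g0 g2]) measurable
  define J where "J y = (\<integral>s. f (s - y) * (s - y - l s)\<^sup>2 \<partial>lborel)" for y
  have J_nonneg: "0 \<le> J y" for y
    unfolding J_def by (intro Bochner_Integration.integral_nonneg mult_nonneg_nonneg f_nonneg) simp
  have J_le: "J y \<le> \<alpha> + \<beta> * y + \<gamma> * y\<^sup>2" for y
    using slack[of y] by (simp add: dual_slack_def J_def)
  have [measurable]: "J \<in> borel_measurable borel"
    unfolding J_def[abs_def] by measurable
  have bound: "integrable lborel (\<lambda>y. \<alpha> * g y + \<beta> * (y * g y) + \<gamma> * (y\<^sup>2 * g y))"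
    using g0 g1 g2 by simp
  have gJ: "integrable lborel (\<lambda>y. g y * J y)"
  proof (rule Bochner_Integration.integrable_bound[OF bound])
    have "norm (g y * J y) \<le> norm (\<alpha> * g y + \<beta> * (y * g y) + \<gamma> * (y\<^sup>2 * g y))" for y
    proof -
      have "0 \<le> g y * J y" using g_nonneg J_nonneg by simp
      moreover have "g y * J y \<le> g y * (\<alpha> + \<beta> * y + \<gamma> * y\<^sup>2)"
        using J_le g_nonneg by (rule mult_left_mono)
      ultimately show ?thesis by (simp add: algebra_simps)
    qed
    then show "AE y in lborel. norm (g y * J y) \<le> norm (\<alpha> * g y + \<beta> * (y * g y) + \<gamma> * (y\<^sup>2 * g y))"
      by simp
  qed measurable
  let ?K = "\<lambda>(y, s). g y * (f (s - y) * (s - y - l s)\<^sup>2)"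
  have K: "integrable (lborel \<Otimes>\<^sub>M lborel) ?K"
  proof (rule lborel_pair.Fubini_integrable)
    have "(\<integral>s. norm (?K (y, s)) \<partial>lborel) = g y * J y" for y
      using f_nonneg g_nonneg by (simp add: J_def abs_mult)
    then show "integrable lborel (\<lambda>y. \<integral>s. norm (?K (y, s)) \<partial>lborel)"
      using gJ by simp
  qed (use inner in auto)
  (* the substitution x = s - y, which exchanges the roles of X and Y given the sum s *)
  have reflect: "(\<integral>x. (x - l s)\<^sup>2 * (f x * g (s - x)) \<partial>lborel)
      = (\<integral>y. g y * (f (s - y) * (s - y - l s)\<^sup>2) \<partial>lborel)" for s
    using lborel_integral_real_affine[of "-1" "\<lambda>x. (x - l s)\<^sup>2 * (f x * g (s - x))" s]
    by (simp add: mult_ac)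
  show "integrable lborel (\<lambda>s. \<integral>x. (x - l s)\<^sup>2 * (f x * g (s - x)) \<partial>lborel)"
    unfolding reflect using lborel_pair.integrable_snd[OF K] by simp
  have "(\<integral>s. (\<integral>x. (x - l s)\<^sup>2 * (f x * g (s - x)) \<partial>lborel) \<partial>lborel) = (\<integral>y. g y * J y \<partial>lborel)"
    unfolding reflect J_def using lborel_pair.Fubini_integral[OF K] by simp
  also have "\<dots> = \<alpha> + \<gamma> * (\<integral>y. y\<^sup>2 * g y \<partial>lborel) - (\<integral>y. dual_slack f \<alpha> \<beta> \<gamma> l y * g y \<partial>lborel)"
  proof -
    have "(\<integral>y. dual_slack f \<alpha> \<beta> \<gamma> l y * g y \<partial>lborel)
        = (\<integral>y. \<alpha> * g y + \<beta> * (y * g y) + \<gamma> * (y\<^sup>2 * g y) - g y * J y \<partial>lborel)"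
      by (intro Bochner_Integration.integral_cong) (simp_all add: dual_slack_def J_def algebra_simps)
    also have "\<dots> = \<alpha> + \<gamma> * (\<integral>y. y\<^sup>2 * g y \<partial>lborel) - (\<integral>y. g y * J y \<partial>lborel)"
      using bound gJ g0 g1 g2 by (simp add: g_mass g_mean)
    finally show ?thesis by simp
  qed
  finally show "(\<integral>s. (\<integral>x. (x - l s)\<^sup>2 * (f x * g (s - x)) \<partial>lborel) \<partial>lborel) =
        \<alpha> + \<gamma> * (\<integral>y. y\<^sup>2 * g y \<partial>lborel) - (\<integral>y. dual_slack f \<alpha> \<beta> \<gamma> l y * g y \<partial>lborel)" .
qed

section \<open>Complementary slackness and optimality\<close>

theorem theorem1:
  fixes \<epsilon> :: real
    and M :: "'a measure" and X :: "'a \<Rightarrow> real"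
    and f g\<^sub>0 l\<^sub>0 :: "real \<Rightarrow> real"
    and \<alpha>\<^sub>0 \<beta>\<^sub>0 \<gamma>\<^sub>0 z\<^sub>0 :: real
  assumes "\<epsilon> > 0"
    and "prob_space M"
    and "\<And>x. 0 \<le> f x"
    and "distributed M lborel X (\<lambda>x. ennreal (f x))"
    and "integrable M (\<lambda>\<omega>. (X \<omega>)\<^sup>2)"
    and "prob_space.expectation M X = 0"
    and "g\<^sub>0 \<in> primal_feasible \<epsilon>"
    and "(\<alpha>\<^sub>0, \<beta>\<^sub>0, \<gamma>\<^sub>0, l\<^sub>0) \<in> dual_feasible f"
    and "\<And>y. 0 = dual_slack f \<alpha>\<^sub>0 \<beta>\<^sub>0 \<gamma>\<^sub>0 l\<^sub>0 y * g\<^sub>0 y"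
    and "z\<^sub>0 = \<epsilon> - (\<integral>y. y\<^sup>2 * g\<^sub>0 y \<partial>lborel)"
    and "0 = \<gamma>\<^sub>0 * z\<^sub>0"
    and "\<And>s. convol f g\<^sub>0 s > 0 \<Longrightarrow> integrable lborel (\<lambda>x. x * f x * g\<^sub>0 (s - x))
           \<Longrightarrow> l\<^sub>0 s = cond_mean f g\<^sub>0 s"
  shows "objective f g\<^sub>0 = (INF g\<in>primal_feasible \<epsilon>. objective f g)"
proof -
  interpret prob_space M by fact
  have f_nonneg: "\<And>x. 0 \<le> f x" by fact
  have dist: "distributed M lborel X (\<lambda>x. ennreal (f x))" by fact
  have dual: "(\<alpha>\<^sub>0, \<beta>\<^sub>0, \<gamma>\<^sub>0, l\<^sub>0) \<in> dual_feasible f" by fact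
  have primal0: "g\<^sub>0 \<in> primal_feasible \<epsilon>" by fact
  have [measurable]: "f \<in> borel_measurable borel"
    using distributed_real_measurable[OF _ dist] f_nonneg by simp
  have f0: "integrable lborel f"
    using distributed_integrable[OF dist, of "\<lambda>_. 1"] f_nonneg by simp
  have f2: "integrable lborel (\<lambda>x. x\<^sup>2 * f x)"
    using distributed_integrable[OF dist, of "\<lambda>x. x\<^sup>2"] f_nonneg assms(5)
    by (simp add: mult.commute)
  have f1: "integrable lborel (\<lambda>x. x * f x)"
    by (rule integrable_first_moment[OF _ f_nonneg f0 f2]) measurable

  let ?bias = "\<lambda>g. \<integral>s. (l\<^sub>0 s - cond_mean f g s)\<^sup>2 * convol f g s \<partial>lborel"
  let ?slack = "\<lambda>g. \<integral>y. dual_slack f \<alpha>\<^sub>0 \<beta>\<^sub>0 \<gamma>\<^sub>0 l\<^sub>0 y * g y \<partial>lborel"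
  (* the two expressions for the mean square error of the dual estimator, equated *)
  have duality: "objective f g = (\<integral>x. x\<^sup>2 * f x \<partial>lborel) + ?bias g
      - (\<alpha>\<^sub>0 + \<gamma>\<^sub>0 * (\<integral>y. y\<^sup>2 * g y \<partial>lborel) - ?slack g)"
    if "g \<in> primal_feasible \<epsilon>" for g
  proof -
    have g: "\<And>y. 0 \<le> g y" "(\<integral>y. g y \<partial>lborel) = 1"
      using that by (auto simp: primal_feasible_def)
    have l: "l\<^sub>0 \<in> borel_measurable borel"
      using dual by (auto simp: dual_feasible_def)
    have "integrable lborel g"
      using g(2) not_integrable_integral_eq by fastforce
    from mean_square_error_eq[OF f_nonneg g(1) f0 f1 f2 this g(2) l
        mean_square_error_integrable[OF _ f_nonneg that dual]]
      mean_square_error_dual[OF _ f_nonneg that dual]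
    show ?thesis by simp
  qed

  (* where the convolution vanishes, the weight removes the error of the dual estimator *)
  have bias0: "?bias g\<^sub>0 = 0"
  proof (rule integral_eq_zero_AE)
    have "integrable lborel g\<^sub>0" and g0_nonneg: "\<And>y. 0 \<le> g\<^sub>0 y"
      using primal0 not_integrable_integral_eq[of lborel g\<^sub>0] by (auto simp: primal_feasible_def)
    from AE_integrable_convolution[OF f1 this(1)]
    show "AE s in lborel. (l\<^sub>0 s - cond_mean f g\<^sub>0 s)\<^sup>2 * convol f g\<^sub>0 s = 0"
    proof eventually_elim
      case (elim s)
      have "0 \<le> convol f g\<^sub>0 s"
        unfolding convol_def
        by (intro Bochner_Integration.integral_nonneg mult_nonneg_nonneg f_nonneg g0_nonneg)
      then show ?case
        using assms(12)[of s] elim by (cases "convol f g\<^sub>0 s = 0") auto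
    qed
  qed
  have slack0: "?slack g\<^sub>0 = 0"
    by (simp flip: assms(9))
  have "\<gamma>\<^sub>0 * (\<integral>y. y\<^sup>2 * g\<^sub>0 y \<partial>lborel) = \<gamma>\<^sub>0 * \<epsilon>"
    using assms(10,11) by auto
  with duality[OF primal0] bias0 slack0
  have optimum: "objective f g\<^sub>0 = (\<integral>x. x\<^sup>2 * f x \<partial>lborel) - (\<alpha>\<^sub>0 + \<gamma>\<^sub>0 * \<epsilon>)"
    by simp

  have lower: "objective f g\<^sub>0 \<le> objective f g" if g: "g \<in> primal_feasible \<epsilon>" for g
  proof -
    have g_nonneg: "\<And>y. 0 \<le> g y" and var: "(\<integral>y. y\<^sup>2 * g y \<partial>lborel) \<le> \<epsilon>"
      using g by (auto simp: primal_feasible_def)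
    have gamma: "0 \<le> \<gamma>\<^sub>0" and slack: "\<And>y. 0 \<le> dual_slack f \<alpha>\<^sub>0 \<beta>\<^sub>0 \<gamma>\<^sub>0 l\<^sub>0 y"
      using dual by (auto simp: dual_feasible_def)
    have "0 \<le> convol f g s" for s
      unfolding convol_def
      by (intro Bochner_Integration.integral_nonneg mult_nonneg_nonneg f_nonneg g_nonneg)
    then have "0 \<le> ?bias g"
      by (intro Bochner_Integration.integral_nonneg) simp
    moreover have "0 \<le> ?slack g"
      using slack g_nonneg by (intro Bochner_Integration.integral_nonneg) simp
    moreover have "\<gamma>\<^sub>0 * (\<integral>y. y\<^sup>2 * g y \<partial>lborel) \<le> \<gamma>\<^sub>0 * \<epsilon>"
      using var gamma by (rule mult_left_mono)
    ultimately show ?thesis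
      using duality[OF g] optimum by simp
  qed
  show ?thesis
    using primal0 lower by (intro cInf_eq_minimum[symmetric]) auto
qed

end
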